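(* Let $K$ be a field. Let $A_1,A_2,\ldots,A_k$ be $m\times m$ paraunitary matrices over $K$ and let $U=(u_{ij})$ be a paraunitary $k\times k$ matrix over $K$ (each in its own finite set of commuting variables; these sets may overlap). Then $$\begin{pmatrix} A_1u_{11} & A_2u_{12} & \cdots & A_ku_{1k}\\ A_1u_{21} & A_2u_{22} & \cdots & A_ku_{2k}\\ \vdots & \vdots & & \vdots\\ A_1u_{k1} & A_2u_{k2} & \cdots & A_ku_{kk}\end{pmatrix}\quad\text{and}\quad \begin{pmatrix} A_1u_{11} & A_1u_{12} & \cdots & A_1u_{1k}\\ A_2u_{21} & A_2u_{22} & \cdots & A_2u_{2k}\\ \vdots & \vdots & & \vdots\\ A_ku_{k1} & A_ku_{k2} & \cdots & A_ku_{kk}\end{pmatrix}$$ are paraunitary $mk\times mk$ matrices in the union of the variables occurring in $A_1,A_2,\ldots,A_k,U$.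
   Context: Let $\mathbf{z}=(z_1,\ldots,z_r)$ be a vector of commuting variables and $\mathbf{z}^{-1}=(z_1^{-1},\ldots,z_r^{-1})$. A paraunitary matrix over $\mathbb{C}$ is a square matrix $U(\mathbf{z})$, with entries in the Laurent polynomial ring $\mathbb{C}[z_1^{\pm1},\ldots,z_r^{\pm1}]$, satisfying $U(\mathbf{z})U^*(\mathbf{z}^{-1})=I$, where $U^*(\mathbf{z}^{-1})$ is obtained from $U(\mathbf{z})$ by transposing, conjugating the complex coefficients and replacing each $z_i$ by $z_i^{-1}$. Over a field $K$ other than $\mathbb{C}$, a paraunitary matrix is a square matrix $U(\mathbf{z})$ with entries in $K[z_1^{\pm1},\ldots,z_r^{\pm1}]$ satisfying $U(\mathbf{z})U^{T}(\mathbf{z}^{-1})=I$, where $U^T(\mathbf{z}^{-1})$ is the transpose with each $z_i$ replaced by $z_i^{-1}$. *)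

theory Defs
  imports
    Complex_Main
    "HOL-Library.Poly_Mapping"
    "Jordan_Normal_Form.Matrix"
begin

text \<open>
  An exponent vector is a finitely supported map from variables to integers, and a Laurent
  polynomial is a finitely supported map from exponent vectors to coefficients. With the
  convolution product of \<^theory>\<open>HOL-Library.Poly_Mapping\<close> this is the Laurent polynomial ring
  in the (possibly infinitely many) variables of type \<open>'v\<close>; the ring in a given set
  of variables \<open>V\<close> is its subring \<open>laurent_ring V\<close>.
\<close>

type_synonym ('v, 'a) laurent = "('v \<Rightarrow>\<^sub>0 int) \<Rightarrow>\<^sub>0 'a"

definition laurent_ring :: "'v set \<Rightarrow> ('v, 'a::zero) laurent set" where
  "laurent_ring V = {p. \<forall>e\<in>Poly_Mapping.keys p. Poly_Mapping.keys e \<subseteq> V}"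

text \<open>Substituting $z^{-1}$ for every variable $z$ negates exponent vectors.\<close>

definition invert_vars :: "('v, 'a::zero) laurent \<Rightarrow> ('v, 'a) laurent" where
  "invert_vars p = Poly_Mapping.map_key uminus p"

lemma lookup_invert_vars [simp]:
  "Poly_Mapping.lookup (invert_vars p) e = Poly_Mapping.lookup p (- e)"
  unfolding invert_vars_def by (subst map_key.rep_eq) simp_all

definition inv_transpose :: "('v, 'a::zero) laurent mat \<Rightarrow> ('v, 'a) laurent mat" where
  "inv_transpose U = transpose_mat (map_mat invert_vars U)"

definition inv_adjoint :: "('v, complex) laurent mat \<Rightarrow> ('v, complex) laurent mat" where
  "inv_adjoint U = transpose_mat (map_mat (\<lambda>p. invert_vars (Poly_Mapping.map cnj p)) U)"

definition laurent_mat :: "'v set \<Rightarrow> nat \<Rightarrow> ('v, 'a::zero) laurent mat set" where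
  "laurent_mat V n = {U \<in> carrier_mat n n. \<forall>i<n. \<forall>j<n. U $$ (i, j) \<in> laurent_ring V}"

text \<open>
  The notion of a paraunitary matrix depends on the field: over the complex numbers the
  coefficients are conjugated, over any other field they are not.
\<close>

definition paraunitary :: "'v set \<Rightarrow> nat \<Rightarrow> ('v, 'a::field) laurent mat \<Rightarrow> bool" where
  "paraunitary V n U \<longleftrightarrow>
     finite V \<and> U \<in> laurent_mat V n \<and> U * inv_transpose U = 1\<^sub>m n"

definition complex_paraunitary :: "'v set \<Rightarrow> nat \<Rightarrow> ('v, complex) laurent mat \<Rightarrow> bool" where
  "complex_paraunitary V n U \<longleftrightarrow>
     finite V \<and> U \<in> laurent_mat V n \<and> U * inv_adjoint U = 1\<^sub>m n"

text \<open>The $k \times k$ array of $m \times m$ blocks \<open>B i j\<close>, with indices starting at 0.\<close>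

definition block_mat :: "nat \<Rightarrow> nat \<Rightarrow> (nat \<Rightarrow> nat \<Rightarrow> 'a mat) \<Rightarrow> 'a mat" where
  "block_mat k m B =
     mat (m * k) (m * k) (\<lambda>(i, j). B (i div m) (j div m) $$ (i mod m, j mod m))"

end

theory Submission
  imports Defs
begin

text \<open>
  Both kinds of paraunitarity have the form \<open>U * (map_mat s U)\<^sup>T = 1\<close> for a map \<open>s\<close> on
  the Laurent polynomial ring: it inverts the variables and, over the complex numbers, also
  conjugates the coefficients. The proof uses one property of \<open>s\<close>, namely that it is
  multiplicative (\<open>invert_map_mult\<close>).

  The \<open>(i, j)\<close> block of \<open>M * (map_mat s M)\<^sup>T\<close> is the sum over \<open>l\<close> of
  \<open>B i l * (map_mat s (B j l))\<^sup>T\<close>, where \<open>B\<close> denotes the blocks of \<open>M\<close>. Because \<open>s\<close> is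
  multiplicative and the ring is commutative, the scalars \<open>u\<^sub>i\<^sub>l\<close> can be collected in front. For the
  first matrix the sum becomes \<open>\<Sum>l. u\<^sub>i\<^sub>l s(u\<^sub>j\<^sub>l) A\<^sub>l A\<^sub>l\<^sup>*\<close>: every \<open>A\<^sub>l A\<^sub>l\<^sup>*\<close> is the
  identity, and the remaining sum of scalars is an entry of \<open>U U\<^sup>* = 1\<close>. For the second it becomes
  \<open>(\<Sum>l. u\<^sub>i\<^sub>l s(u\<^sub>j\<^sub>l)) A\<^sub>i A\<^sub>j\<^sup>*\<close>: the scalar vanishes unless \<open>i = j\<close>, and then
  \<open>A\<^sub>i A\<^sub>i\<^sup>* = 1\<close>. This is \<open>block_scaled_unitary\<close>. That the entries only involve the
  variables of the union holds because \<open>laurent_ring\<close> is closed under products and monotone in the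
  set of variables.
\<close>

section \<open>Laurent polynomials\<close>

lemma laurent_ring_mono: "V \<subseteq> W \<Longrightarrow> laurent_ring V \<subseteq> laurent_ring W"
  unfolding laurent_ring_def by blast

lemma laurent_ring_mult:
  fixes p q :: "('v, 'a::semiring_0) laurent"
  assumes p: "p \<in> laurent_ring V" and q: "q \<in> laurent_ring V"
  shows "p * q \<in> laurent_ring V"
  unfolding laurent_ring_def
proof (intro CollectI ballI)
  fix e assume "e \<in> Poly_Mapping.keys (p * q)"
  then obtain a b where e: "e = a + b"
    and a: "a \<in> Poly_Mapping.keys p" and b: "b \<in> Poly_Mapping.keys q"
    using keys_mult[of p q] by blast
  have "Poly_Mapping.keys e \<subseteq> Poly_Mapping.keys a \<union> Poly_Mapping.keys b"
    unfolding e by (rule keys_add)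
  also have "\<dots> \<subseteq> V"
    using a b p q unfolding laurent_ring_def by blast
  finally show "Poly_Mapping.keys e \<subseteq> V" .
qed

text \<open>
  The common form of the two involutions: \<open>h\<close> is the identity over a general field and complex
  conjugation over the complex numbers.
\<close>

definition invert_map :: "('a \<Rightarrow> 'a) \<Rightarrow> ('v, 'a::zero) laurent \<Rightarrow> ('v, 'a) laurent" where
  "invert_map h p = invert_vars (Poly_Mapping.map h p)"

lemma map_id_poly_mapping: "Poly_Mapping.map (\<lambda>x. x) p = p"
  by (rule poly_mapping_eqI) (simp add: Poly_Mapping.map.rep_eq when_def)

lemma inv_transpose_eq_invert_map:
  "inv_transpose U = transpose_mat (map_mat (invert_map (\<lambda>x. x)) U)"
  unfolding inv_transpose_def invert_map_def map_id_poly_mapping ..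

lemma inv_adjoint_eq_invert_map:
  "inv_adjoint U = transpose_mat (map_mat (invert_map cnj) U)"
  unfolding inv_adjoint_def invert_map_def ..

lemma lookup_invert_map:
  assumes "h 0 = 0"
  shows "Poly_Mapping.lookup (invert_map h p) e = h (Poly_Mapping.lookup p (- e))"
  using assms by (simp add: invert_map_def Poly_Mapping.map.rep_eq when_def)

lemma invert_map_add:
  fixes h :: "'a::monoid_add \<Rightarrow> 'a"
  assumes "h 0 = 0" and "\<And>x y. h (x + y) = h x + h y"
  shows "invert_map h (p + q) = invert_map h p + invert_map h q"
  by (rule poly_mapping_eqI) (simp add: lookup_invert_map lookup_add assms)

lemma invert_map_zero: "h 0 = 0 \<Longrightarrow> invert_map h 0 = 0"
  by (rule poly_mapping_eqI) (simp add: lookup_invert_map)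

lemma invert_map_single:
  assumes "h 0 = 0"
  shows "invert_map h (Poly_Mapping.single e c) = Poly_Mapping.single (- e) (h c)"
  by (rule poly_mapping_eqI)
    (auto simp: lookup_invert_map lookup_single assms when_def)

lemma poly_mapping_single_add_induct [case_names zero single_add]:
  fixes p :: "'b \<Rightarrow>\<^sub>0 'a::monoid_add"
  assumes "P 0"
    and "\<And>e c q. P q \<Longrightarrow> P (Poly_Mapping.single e c + q)"
  shows "P p"
proof (induction p rule: update_induct)
  case const
  show ?case by (fact assms(1))
next
  case (update q e c)
  then have "Poly_Mapping.lookup q e = 0"
    by (simp add: in_keys_iff)
  then have "Poly_Mapping.update e c q = Poly_Mapping.single e c + q"
    by (intro poly_mapping_eqI) (auto simp: lookup_update lookup_add lookup_single when_def)
  then show ?case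
    using assms(2)[OF update(3)] by simp
qed

text \<open>
  Both sides are biadditive in \<open>p\<close> and \<open>q\<close>, so it suffices to compare them on monomials, where the
  claim says that negation of exponents is additive and \<open>h\<close> is multiplicative.
\<close>

lemma invert_map_mult:
  fixes h :: "'a::comm_semiring_0 \<Rightarrow> 'a"
  assumes zero: "h 0 = 0" and add: "\<And>x y. h (x + y) = h x + h y"
    and mult: "\<And>x y. h (x * y) = h x * h y"
  shows "invert_map h (p * q) = invert_map h p * invert_map h q"
proof (induction p rule: poly_mapping_single_add_induct)
  case zero
  show ?case by (simp add: invert_map_zero assms(1))
next
  case (single_add e c p)
  have "invert_map h (Poly_Mapping.single e c * q)
      = invert_map h (Poly_Mapping.single e c) * invert_map h q"
    by (induction q rule: poly_mapping_single_add_induct)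
      (simp_all add: invert_map_zero invert_map_add invert_map_single mult_single
        distrib_left assms)
  with single_add show ?case
    by (simp add: distrib_right invert_map_add assms)
qed

section \<open>Block matrices that are unitary for a multiplicative map\<close>

lemma mult_transpose_map_eq_one_iff:
  assumes "M \<in> carrier_mat n n"
  shows "M * transpose_mat (map_mat s M) = 1\<^sub>m n \<longleftrightarrow>
    (\<forall>i<n. \<forall>j<n. (\<Sum>l<n. M $$ (i, l) * s (M $$ (j, l))) = (if i = j then 1 else 0))"
proof -
  have "(M * transpose_mat (map_mat s M)) $$ (i, j) = (\<Sum>l<n. M $$ (i, l) * s (M $$ (j, l)))"
    if "i < n" "j < n" for i j
    using assms that by (auto simp: scalar_prod_def lessThan_atLeast0 intro!: sum.cong)
  with assms show ?thesis
    by (auto simp: mat_eq_iff)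
qed

lemma sum_div_mod:
  fixes f :: "nat \<Rightarrow> nat \<Rightarrow> 'a::comm_monoid_add"
  shows "(\<Sum>t<m * k. f (t div m) (t mod m)) = (\<Sum>l<k. \<Sum>r<m. f l r)"
proof -
  have "(\<Sum>t<m * k. f (t div m) (t mod m))
      = (\<Sum>l<k. \<Sum>t = l * m..<l * m + m. f (t div m) (t mod m))"
    using sum.nat_group[of "\<lambda>t. f (t div m) (t mod m)" m k] by (simp add: mult.commute)
  also have "\<dots> = (\<Sum>l<k. \<Sum>r<m. f l r)"
  proof (rule sum.cong[OF refl])
    fix l
    show "(\<Sum>t = l * m..<l * m + m. f (t div m) (t mod m)) = (\<Sum>r<m. f l r)"
      using sum.shift_bounds_nat_ivl[of "\<lambda>t. f (t div m) (t mod m)" 0 "l * m" m]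
      by (simp add: lessThan_atLeast0 add.commute)
  qed
  finally show ?thesis .
qed

lemma block_mat_carrier [simp]: "block_mat k m B \<in> carrier_mat (m * k) (m * k)"
  by (simp add: block_mat_def)

lemma div_mod_less_of_less_mult:
  fixes i m k :: nat
  assumes "i < m * k"
  shows "i div m < k" and "i mod m < m"
  using assms by (cases m; simp add: less_mult_imp_div_less mult.commute)+

lemma block_mat_index:
  assumes "i < m * k" and "j < m * k"
  shows "block_mat k m B $$ (i, j) = B (i div m) (j div m) $$ (i mod m, j mod m)"
  using assms by (simp add: block_mat_def)

text \<open>
  Writing a column index as \<open>l * m + r\<close> turns an entry of the product into a double sum, over the
  blocks \<open>l\<close> and over the position \<open>r\<close> inside a block. The hypothesis says that the rows of
  blocks are orthonormal: \<open>\<Sum>l. B i l * (map_mat s (B j l))\<^sup>T\<close> is \<open>1\<close> if \<open>i = j\<close> and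
  \<open>0\<close> otherwise.
\<close>

lemma block_mat_unitaryI:
  fixes B :: "nat \<Rightarrow> nat \<Rightarrow> 'a::comm_semiring_1 mat"
  assumes "\<And>i j p q. \<lbrakk>i < k; j < k; p < m; q < m\<rbrakk> \<Longrightarrow>
    (\<Sum>l<k. \<Sum>r<m. B i l $$ (p, r) * s (B j l $$ (q, r))) = (if i = j \<and> p = q then 1 else 0)"
  shows "block_mat k m B * transpose_mat (map_mat s (block_mat k m B)) = 1\<^sub>m (m * k)"
  unfolding mult_transpose_map_eq_one_iff[OF block_mat_carrier]
proof (intro allI impI)
  fix i j assume i: "i < m * k" and j: "j < m * k"
  have "(\<Sum>t<m * k. block_mat k m B $$ (i, t) * s (block_mat k m B $$ (j, t)))
      = (\<Sum>t<m * k. B (i div m) (t div m) $$ (i mod m, t mod m)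
          * s (B (j div m) (t div m) $$ (j mod m, t mod m)))"
    using i j by (intro sum.cong) (auto simp: block_mat_index)
  also have "\<dots> = (\<Sum>l<k. \<Sum>r<m. B (i div m) l $$ (i mod m, r) * s (B (j div m) l $$ (j mod m, r)))"
    by (rule sum_div_mod)
  also have "\<dots> = (if i div m = j div m \<and> i mod m = j mod m then 1 else 0)"
    using i j by (intro assms div_mod_less_of_less_mult)
  also have "\<dots> = (if i = j then 1 else 0)"
    by (metis div_mult_mod_eq)
  finally show "(\<Sum>t<m * k. block_mat k m B $$ (i, t) * s (block_mat k m B $$ (j, t)))
      = (if i = j then 1 else 0)" .
qed

text \<open>
  In each case the scalars are moved in front of the inner sum, which is then an entry of
  \<open>A l * (map_mat s (A l))\<^sup>T\<close> in the first case and of \<open>A i * (map_mat s (A j))\<^sup>T\<close> in the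
  second.
\<close>

lemma block_scaled_unitary:
  fixes A :: "nat \<Rightarrow> 'a::comm_semiring_1 mat" and U :: "'a mat"
  assumes mult: "\<And>x y. s (x * y) = s x * s y"
    and A: "\<And>i. i < k \<Longrightarrow> A i \<in> carrier_mat m m"
    and A1: "\<And>i. i < k \<Longrightarrow> A i * transpose_mat (map_mat s (A i)) = 1\<^sub>m m"
    and U: "U \<in> carrier_mat k k" and U1: "U * transpose_mat (map_mat s U) = 1\<^sub>m k"
  shows block_scaled_columns_unitary:
      "block_mat k m (\<lambda>i j. U $$ (i, j) \<cdot>\<^sub>m A j)
        * transpose_mat (map_mat s (block_mat k m (\<lambda>i j. U $$ (i, j) \<cdot>\<^sub>m A j))) = 1\<^sub>m (m * k)"
    and block_scaled_rows_unitary: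
      "block_mat k m (\<lambda>i j. U $$ (i, j) \<cdot>\<^sub>m A i)
        * transpose_mat (map_mat s (block_mat k m (\<lambda>i j. U $$ (i, j) \<cdot>\<^sub>m A i))) = 1\<^sub>m (m * k)"
proof -
  have A_rows: "(\<Sum>r<m. A i $$ (p, r) * s (A i $$ (q, r))) = (if p = q then 1 else 0)"
    if "i < k" "p < m" "q < m" for i p q
    using A1[OF that(1)] that unfolding mult_transpose_map_eq_one_iff[OF A[OF that(1)]] by blast
  have U_rows: "(\<Sum>l<k. U $$ (i, l) * s (U $$ (j, l))) = (if i = j then 1 else 0)"
    if "i < k" "j < k" for i j
    using U1 that unfolding mult_transpose_map_eq_one_iff[OF U] by blast
  show "block_mat k m (\<lambda>i j. U $$ (i, j) \<cdot>\<^sub>m A j)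
      * transpose_mat (map_mat s (block_mat k m (\<lambda>i j. U $$ (i, j) \<cdot>\<^sub>m A j))) = 1\<^sub>m (m * k)"
  proof (rule block_mat_unitaryI)
    fix i j p q assume i: "i < k" and j: "j < k" and p: "p < m" and q: "q < m"
    have "(\<Sum>l<k. \<Sum>r<m. (U $$ (i, l) \<cdot>\<^sub>m A l) $$ (p, r) * s ((U $$ (j, l) \<cdot>\<^sub>m A l) $$ (q, r)))
        = (\<Sum>l<k. (U $$ (i, l) * s (U $$ (j, l))) * (\<Sum>r<m. A l $$ (p, r) * s (A l $$ (q, r))))"
      unfolding sum_distrib_left
    proof (intro sum.cong refl)
      fix l r assume "l \<in> {..<k}" "r \<in> {..<m}"
      with A[of l] p q show "(U $$ (i, l) \<cdot>\<^sub>m A l) $$ (p, r) * s ((U $$ (j, l) \<cdot>\<^sub>m A l) $$ (q, r))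
          = (U $$ (i, l) * s (U $$ (j, l))) * (A l $$ (p, r) * s (A l $$ (q, r)))"
        by (simp add: mult ac_simps)
    qed
    also have "\<dots> = (\<Sum>l<k. (U $$ (i, l) * s (U $$ (j, l))) * (if p = q then 1 else 0))"
      using p q by (intro sum.cong refl) (simp add: A_rows)
    also have "\<dots> = (if i = j \<and> p = q then 1 else 0)"
      using i j by (simp add: U_rows)
    finally show "(\<Sum>l<k. \<Sum>r<m. (U $$ (i, l) \<cdot>\<^sub>m A l) $$ (p, r) * s ((U $$ (j, l) \<cdot>\<^sub>m A l) $$ (q, r)))
        = (if i = j \<and> p = q then 1 else 0)" .
  qed
  show "block_mat k m (\<lambda>i j. U $$ (i, j) \<cdot>\<^sub>m A i)
      * transpose_mat (map_mat s (block_mat k m (\<lambda>i j. U $$ (i, j) \<cdot>\<^sub>m A i))) = 1\<^sub>m (m * k)"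
  proof (rule block_mat_unitaryI)
    fix i j p q assume i: "i < k" and j: "j < k" and p: "p < m" and q: "q < m"
    have "(\<Sum>l<k. \<Sum>r<m. (U $$ (i, l) \<cdot>\<^sub>m A i) $$ (p, r) * s ((U $$ (j, l) \<cdot>\<^sub>m A j) $$ (q, r)))
        = (\<Sum>l<k. (U $$ (i, l) * s (U $$ (j, l))) * (\<Sum>r<m. A i $$ (p, r) * s (A j $$ (q, r))))"
      unfolding sum_distrib_left
    proof (intro sum.cong refl)
      fix l r assume "l \<in> {..<k}" "r \<in> {..<m}"
      with A[OF i] A[OF j] p q
      show "(U $$ (i, l) \<cdot>\<^sub>m A i) $$ (p, r) * s ((U $$ (j, l) \<cdot>\<^sub>m A j) $$ (q, r))
          = (U $$ (i, l) * s (U $$ (j, l))) * (A i $$ (p, r) * s (A j $$ (q, r)))"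
        by (simp add: mult ac_simps)
    qed
    also have "\<dots> = (\<Sum>l<k. U $$ (i, l) * s (U $$ (j, l))) * (\<Sum>r<m. A i $$ (p, r) * s (A j $$ (q, r)))"
      by (rule sum_distrib_right[symmetric])
    also have "\<dots> = (if i = j \<and> p = q then 1 else 0)"
      using i j p q by (auto simp: U_rows A_rows)
    finally show "(\<Sum>l<k. \<Sum>r<m. (U $$ (i, l) \<cdot>\<^sub>m A i) $$ (p, r) * s ((U $$ (j, l) \<cdot>\<^sub>m A j) $$ (q, r)))
        = (if i = j \<and> p = q then 1 else 0)" .
  qed
qed

section \<open>Paraunitary block matrices\<close>

text \<open>
  The index function \<open>g\<close> selects the matrix placed in block \<open>(i, j)\<close>; the two arrangements are
  \<open>g i j = j\<close> and \<open>g i j = i\<close>.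
\<close>

lemma block_scaled_laurent_mat:
  fixes A :: "nat \<Rightarrow> ('v, 'a::comm_semiring_0) laurent mat"
  assumes A: "\<And>i. i < k \<Longrightarrow> A i \<in> laurent_mat (V i) m" and U: "U \<in> laurent_mat W k"
    and g: "\<And>i j. \<lbrakk>i < k; j < k\<rbrakk> \<Longrightarrow> g i j < k"
  shows "block_mat k m (\<lambda>i j. U $$ (i, j) \<cdot>\<^sub>m A (g i j)) \<in> laurent_mat ((\<Union>i<k. V i) \<union> W) (m * k)"
  unfolding laurent_mat_def
proof (intro CollectI conjI allI impI)
  fix i j assume i: "i < m * k" and j: "j < m * k"
  let ?i = "i div m" and ?j = "j div m"
  note less = div_mod_less_of_less_mult[OF i] div_mod_less_of_less_mult[OF j]
  note g_less = g[OF less(1,3)]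
  have entry: "block_mat k m (\<lambda>i j. U $$ (i, j) \<cdot>\<^sub>m A (g i j)) $$ (i, j)
      = U $$ (?i, ?j) * A (g ?i ?j) $$ (i mod m, j mod m)"
    using A[OF g_less] less by (auto simp: block_mat_index[OF i j] laurent_mat_def)
  have "U $$ (?i, ?j) \<in> laurent_ring W"
    using U less by (auto simp: laurent_mat_def)
  moreover have "A (g ?i ?j) $$ (i mod m, j mod m) \<in> laurent_ring (V (g ?i ?j))"
    using A[OF g_less] less by (auto simp: laurent_mat_def)
  moreover have "V (g ?i ?j) \<subseteq> (\<Union>i<k. V i)"
    using g_less by blast
  ultimately show "block_mat k m (\<lambda>i j. U $$ (i, j) \<cdot>\<^sub>m A (g i j)) $$ (i, j)
      \<in> laurent_ring ((\<Union>i<k. V i) \<union> W)"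
    unfolding entry by (meson laurent_ring_mono laurent_ring_mult le_supI1 subsetD sup_ge2)
qed simp

theorem proposition2p6:
  fixes k m :: nat
    and V :: "nat \<Rightarrow> 'v set"
    and W :: "'v set"
  shows
    "(\<forall>(A :: nat \<Rightarrow> ('v, 'a::field) laurent mat) (U :: ('v, 'a) laurent mat).
        (\<forall>i<k. paraunitary (V i) m (A i)) \<longrightarrow> paraunitary W k U \<longrightarrow>
          paraunitary ((\<Union>i<k. V i) \<union> W) (m * k) (block_mat k m (\<lambda>i j. U $$ (i, j) \<cdot>\<^sub>m A j)) \<and>
          paraunitary ((\<Union>i<k. V i) \<union> W) (m * k) (block_mat k m (\<lambda>i j. U $$ (i, j) \<cdot>\<^sub>m A i)))
     \<and>
     (\<forall>(A :: nat \<Rightarrow> ('v, complex) laurent mat) (U :: ('v, complex) laurent mat).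
        (\<forall>i<k. complex_paraunitary (V i) m (A i)) \<longrightarrow> complex_paraunitary W k U \<longrightarrow>
          complex_paraunitary ((\<Union>i<k. V i) \<union> W) (m * k) (block_mat k m (\<lambda>i j. U $$ (i, j) \<cdot>\<^sub>m A j)) \<and>
          complex_paraunitary ((\<Union>i<k. V i) \<union> W) (m * k) (block_mat k m (\<lambda>i j. U $$ (i, j) \<cdot>\<^sub>m A i)))"
proof (intro conjI allI impI)
  fix A :: "nat \<Rightarrow> ('v, 'a::field) laurent mat" and U :: "('v, 'a) laurent mat"
  assume "\<forall>i<k. paraunitary (V i) m (A i)" and "paraunitary W k U"
  then have fin: "finite ((\<Union>i<k. V i) \<union> W)"
    and A: "\<And>i. i < k \<Longrightarrow> A i \<in> laurent_mat (V i) m"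
    and A1: "\<And>i. i < k \<Longrightarrow> A i * transpose_mat (map_mat (invert_map (\<lambda>x. x)) (A i)) = 1\<^sub>m m"
    and U: "U \<in> laurent_mat W k"
    and U1: "U * transpose_mat (map_mat (invert_map (\<lambda>x. x)) U) = 1\<^sub>m k"
    by (auto simp: paraunitary_def inv_transpose_eq_invert_map)
  have carrier: "\<And>i. i < k \<Longrightarrow> A i \<in> carrier_mat m m" "U \<in> carrier_mat k k"
    using A U by (auto simp: laurent_mat_def)
  have mult: "invert_map (\<lambda>x. x) (p * q) = invert_map (\<lambda>x. x) p * invert_map (\<lambda>x. x) q"
    for p q :: "('v, 'a) laurent"
    by (rule invert_map_mult) simp_all
  show "paraunitary ((\<Union>i<k. V i) \<union> W) (m * k) (block_mat k m (\<lambda>i j. U $$ (i, j) \<cdot>\<^sub>m A j))"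
    unfolding paraunitary_def inv_transpose_eq_invert_map
    using fin block_scaled_laurent_mat[where A = A and V = V and g = "\<lambda>i j. j", OF A U]
      block_scaled_columns_unitary[where A = A, OF mult carrier(1) A1 carrier(2) U1] by blast
  show "paraunitary ((\<Union>i<k. V i) \<union> W) (m * k) (block_mat k m (\<lambda>i j. U $$ (i, j) \<cdot>\<^sub>m A i))"
    unfolding paraunitary_def inv_transpose_eq_invert_map
    using fin block_scaled_laurent_mat[where A = A and V = V and g = "\<lambda>i j. i", OF A U]
      block_scaled_rows_unitary[where A = A, OF mult carrier(1) A1 carrier(2) U1] by blast
next
  fix A :: "nat \<Rightarrow> ('v, complex) laurent mat" and U :: "('v, complex) laurent mat"
  assume "\<forall>i<k. complex_paraunitary (V i) m (A i)" and "complex_paraunitary W k U"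
  then have fin: "finite ((\<Union>i<k. V i) \<union> W)"
    and A: "\<And>i. i < k \<Longrightarrow> A i \<in> laurent_mat (V i) m"
    and A1: "\<And>i. i < k \<Longrightarrow> A i * transpose_mat (map_mat (invert_map cnj) (A i)) = 1\<^sub>m m"
    and U: "U \<in> laurent_mat W k"
    and U1: "U * transpose_mat (map_mat (invert_map cnj) U) = 1\<^sub>m k"
    by (auto simp: complex_paraunitary_def inv_adjoint_eq_invert_map)
  have carrier: "\<And>i. i < k \<Longrightarrow> A i \<in> carrier_mat m m" "U \<in> carrier_mat k k"
    using A U by (auto simp: laurent_mat_def)
  have mult: "invert_map cnj (p * q) = invert_map cnj p * invert_map cnj q"
    for p q :: "('v, complex) laurent"
    by (rule invert_map_mult) simp_all
  show "complex_paraunitary ((\<Union>i<k. V i) \<union> W) (m * k) (block_mat k m (\<lambda>i j. U $$ (i, j) \<cdot>\<^sub>m A j))"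
    unfolding complex_paraunitary_def inv_adjoint_eq_invert_map
    using fin block_scaled_laurent_mat[where A = A and V = V and g = "\<lambda>i j. j", OF A U]
      block_scaled_columns_unitary[where A = A, OF mult carrier(1) A1 carrier(2) U1] by blast
  show "complex_paraunitary ((\<Union>i<k. V i) \<union> W) (m * k) (block_mat k m (\<lambda>i j. U $$ (i, j) \<cdot>\<^sub>m A i))"
    unfolding complex_paraunitary_def inv_adjoint_eq_invert_map
    using fin block_scaled_laurent_mat[where A = A and V = V and g = "\<lambda>i j. i", OF A U]
      block_scaled_rows_unitary[where A = A, OF mult carrier(1) A1 carrier(2) U1] by blast
qed

end
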